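(* Let $\Omega$ be a closed subset of $\mathcal{M}$ equipped with the $\tau$-topology. Suppose there exist $u,l\in L_1(\mathcal{X},P)$ such that $$u\le\frac{dQ}{dP}\le l\quad(P\text{-a.e.})\quad\text{for all }Q\in\Omega\cap\mathrm{dom}\,\phi .$$ Then there exists at least one $\phi$-projection of $P$ on $\Omega$ whenever $\phi(\Omega,P)$ is finite.
   Context: $(\mathcal{X},\mathcal{B})$ is a measurable space and $P$ a given probability measure on it. $\mathcal{M}$ is the real vector space of all signed finite measures on $(\mathcal{X},\mathcal{B})$, and $\mathcal{M}(P)$ the subspace of those absolutely continuous w.r.t. $P$. The function $\varphi:\mathbb{R}\to[0,+\infty]$ is proper, convex and closed, with $\varphi(1)=0$, and its domain $\{x:\varphi(x)<\infty\}$ is an interval with endpoints $a_\varphi<1<b_\varphi$ (finite or infinite). Closed means that $\varphi(x)\to\varphi(a_\varphi)$ as $x\downarrow a_\varphi$ if $a_\varphi$ is finite, and $\varphi(x)\to\varphi(b_\varphi)$ as $x\uparrow b_\varphi$ if $b_\varphi$ is finite (equivalently, $\varphi$ is lower semi-continuous). For $Q\in\mathcal{M}(P)$ put $\phi(Q,P):=\int_{\mathcal{X}}\varphi\left(\frac{dQ}{dP}\right)dP$, and $\phi(Q,P):=+\infty$ if $Q\in\mathcal{M}\setminus\mathcal{M}(P)$. $\mathrm{dom}\,\phi:=\{Q\in\mathcal{M}:\phi(Q,P)<\infty\}$. For $\Omega\subseteq\mathcal{M}$, $\phi(\Omega,P):=\inf_{Q\in\Omega}\phi(Q,P)$. When $\phi(\Omega,P)<\infty$,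 a $\phi$-projection of $P$ on $\Omega$ is a measure $Q^*\in\Omega$ such that $\phi(Q^*,P)\le\phi(Q,P)$ for all $Q\in\Omega$. The $\tau$-topology on $\mathcal{M}$ is the weakest topology making all maps $Q\mapsto\int f\,dQ$ continuous, for $f$ a bounded measurable real valued function on $\mathcal{X}$. *)

theory Defs
  imports "HOL-Probability.Probability"
begin

text \<open>A measurable space is given by any measure \<open>M\<close> on it: only \<open>space M\<close> and \<open>sets M\<close> matter
  here. A finite signed measure is a real set function on \<open>sets M\<close>, extended by 0 to
  non-measurable sets so that equality of signed measures is equality of functions.\<close>

definition signed_measures :: "'a measure \<Rightarrow> ('a set \<Rightarrow> real) set" where
  "signed_measures M = {Q. Q {} = 0 \<and>
     (\<forall>A :: nat \<Rightarrow> 'a set. range A \<subseteq> sets M \<longrightarrow> disjoint_family A \<longrightarrow>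
        (\<lambda>i. Q (A i)) sums Q (\<Union>i. A i)) \<and>
     (\<forall>A. A \<notin> sets M \<longrightarrow> Q A = 0)}"

text \<open>The two parts of the Jordan decomposition. Since \<open>Q {} = 0\<close>, nothing is lost by
  \<open>ennreal\<close> truncating negative values to 0.\<close>

definition pos_part_measure :: "'a measure \<Rightarrow> ('a set \<Rightarrow> real) \<Rightarrow> 'a measure" where
  "pos_part_measure M Q =
     measure_of (space M) (sets M) (\<lambda>A. SUP B\<in>{B \<in> sets M. B \<subseteq> A}. ennreal (Q B))"

definition neg_part_measure :: "'a measure \<Rightarrow> ('a set \<Rightarrow> real) \<Rightarrow> 'a measure" where
  "neg_part_measure M Q = pos_part_measure M (\<lambda>A. - Q A)"

definition signed_integral :: "'a measure \<Rightarrow> ('a set \<Rightarrow> real) \<Rightarrow> ('a \<Rightarrow> real) \<Rightarrow> real" where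
  "signed_integral M Q f =
     (\<integral>x. f x \<partial>pos_part_measure M Q) - (\<integral>x. f x \<partial>neg_part_measure M Q)"

definition tau_topology :: "'a measure \<Rightarrow> ('a set \<Rightarrow> real) topology" where
  "tau_topology M = topology_generated_by
     {{Q \<in> signed_measures M. signed_integral M Q f \<in> U} | f U.
        f \<in> borel_measurable M \<and> bounded (f ` space M) \<and> open U}"

definition ac_signed_measures :: "'a measure \<Rightarrow> ('a set \<Rightarrow> real) set" where
  "ac_signed_measures P =
     {Q \<in> signed_measures P. \<forall>A\<in>sets P. emeasure P A = 0 \<longrightarrow> Q A = 0}"

text \<open>A version of \<open>dQ/dP\<close>, for \<open>Q\<close> absolutely continuous with respect to \<open>P\<close>
  (argument order as in \<^const>\<open>RN_deriv\<close>).\<close>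

definition signed_RN_deriv :: "'a measure \<Rightarrow> ('a set \<Rightarrow> real) \<Rightarrow> 'a \<Rightarrow> real" where
  "signed_RN_deriv P Q =
     (SOME g. integrable P g \<and> (\<forall>A\<in>sets P. Q A = set_lebesgue_integral P A g))"

definition eff_domain :: "(real \<Rightarrow> ennreal) \<Rightarrow> real set" where
  "eff_domain \<phi> = {x. \<phi> x < \<infinity>}"

definition lower_endpoint :: "(real \<Rightarrow> ennreal) \<Rightarrow> ereal" where
  "lower_endpoint \<phi> = (INF x\<in>eff_domain \<phi>. ereal x)"

definition upper_endpoint :: "(real \<Rightarrow> ennreal) \<Rightarrow> ereal" where
  "upper_endpoint \<phi> = (SUP x\<in>eff_domain \<phi>. ereal x)"

definition proper_fun :: "(real \<Rightarrow> ennreal) \<Rightarrow> bool" where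
  "proper_fun \<phi> \<longleftrightarrow> eff_domain \<phi> \<noteq> {}"

text \<open>Products in \<^typ>\<open>ennreal\<close> satisfy \<open>0 * \<infinity> = 0\<close>, so the cases \<open>t = 0\<close> and \<open>t = 1\<close> are harmless.\<close>

definition convex_fun :: "(real \<Rightarrow> ennreal) \<Rightarrow> bool" where
  "convex_fun \<phi> \<longleftrightarrow> (\<forall>x y. \<forall>t\<in>{0..1}.
     \<phi> ((1 - t) * x + t * y) \<le> ennreal (1 - t) * \<phi> x + ennreal t * \<phi> y)"

text \<open>Closedness in the sense of convex analysis; for convex functions it amounts to lower
  semicontinuity. The value at a finite endpoint may be \<open>\<infinity>\<close>.\<close>

definition closed_fun :: "(real \<Rightarrow> ennreal) \<Rightarrow> bool" where
  "closed_fun \<phi> \<longleftrightarrow>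
     (\<forall>a. lower_endpoint \<phi> = ereal a \<longrightarrow> (\<phi> \<longlongrightarrow> \<phi> a) (at_right a)) \<and>
     (\<forall>b. upper_endpoint \<phi> = ereal b \<longrightarrow> (\<phi> \<longlongrightarrow> \<phi> b) (at_left b))"

definition divergence_function :: "(real \<Rightarrow> ennreal) \<Rightarrow> bool" where
  "divergence_function \<phi> \<longleftrightarrow>
     proper_fun \<phi> \<and> convex_fun \<phi> \<and> closed_fun \<phi> \<and> \<phi> 1 = 0 \<and>
     is_interval (eff_domain \<phi>) \<and> lower_endpoint \<phi> < 1 \<and> 1 < upper_endpoint \<phi>"

definition phi_divergence :: "(real \<Rightarrow> ennreal) \<Rightarrow> 'a measure \<Rightarrow> ('a set \<Rightarrow> real) \<Rightarrow> ennreal" where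
  "phi_divergence \<phi> P Q =
     (if Q \<in> ac_signed_measures P then \<integral>\<^sup>+x. \<phi> (signed_RN_deriv P Q x) \<partial>P else \<infinity>)"

definition dom_divergence :: "(real \<Rightarrow> ennreal) \<Rightarrow> 'a measure \<Rightarrow> ('a set \<Rightarrow> real) set" where
  "dom_divergence \<phi> P = {Q \<in> signed_measures P. phi_divergence \<phi> P Q < \<infinity>}"

definition phi_divergence_set ::
    "(real \<Rightarrow> ennreal) \<Rightarrow> 'a measure \<Rightarrow> ('a set \<Rightarrow> real) set \<Rightarrow> ennreal" where
  "phi_divergence_set \<phi> P \<Omega> = (INF Q\<in>\<Omega>. phi_divergence \<phi> P Q)"

definition is_phi_projection ::
    "(real \<Rightarrow> ennreal) \<Rightarrow> 'a measure \<Rightarrow> ('a set \<Rightarrow> real) set \<Rightarrow> ('a set \<Rightarrow> real) \<Rightarrow> bool" where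
  "is_phi_projection \<phi> P \<Omega> Q \<longleftrightarrow>
     Q \<in> \<Omega> \<and> (\<forall>Q'\<in>\<Omega>. phi_divergence \<phi> P Q \<le> phi_divergence \<phi> P Q')"

end

theory Submission
  imports Defs
begin

text \<open>
  The direct method of the calculus of variations. A minimising sequence \<open>Q\<^sub>n\<close> in \<open>\<Omega>\<close> has finite
  divergence, so it has densities \<open>g\<^sub>n\<close> with \<open>u \<le> g\<^sub>n \<le> l\<close>. A limit of the \<open>Q\<^sub>n\<close> in the
  \<open>\<tau>\<close>-topology belongs to \<open>\<Omega>\<close>, because \<open>\<Omega>\<close> is closed, and it is a minimiser as soon as the
  divergence is lower semicontinuous along the convergence. So two things are needed: compactness and
  lower semicontinuity.

  Compactness. As a function on sets, each \<open>Q\<^sub>n\<close> lies in the product of the compact intervals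
  \<open>[\<integral>\<^sub>A u dP, \<integral>\<^sub>A l dP]\<close>. By Tychonoff's theorem there is a proper filter \<open>F\<close> on the indices,
  finer than the sequential one, along which \<open>Q\<^sub>n(A)\<close> converges for every \<open>A\<close>
  (\<open>coordinatewise_cluster_filter\<close>). Convergence along a filter suffices throughout, so no
  subsequence is extracted and the \<open>\<sigma>\<close>-algebra may be as large as it likes. The limit \<open>R\<close> is
  finitely additive, and the two integral bounds make it countably additive
  (\<open>ac_signed_measure_dominated_limit\<close>). Bounded measurable functions are uniform limits of simple
  functions and the densities are bounded in \<open>L\<^sub>1\<close>, so setwise convergence is
  \<open>\<tau>\<close>-convergence (\<open>limitin_tau_topology\<close>).

  Lower semicontinuity. A closed convex \<open>\<phi>\<close> is a supremum of countably many affine functions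
  \<open>a\<^sub>i + b\<^sub>i y\<close> (\<open>countable_affine_representation\<close>). Over a measurable set, the integral of
  \<open>a\<^sub>i + b\<^sub>i dQ/dP\<close> is \<open>a\<^sub>i P(A) + b\<^sub>i Q(A)\<close>, which is continuous under setwise convergence.
  Splitting the space according to which affine function is the largest one gives lower semicontinuity
  of \<open>\<integral> \<phi>(dQ/dP) dP\<close> (\<open>convex_integral_lower_semicontinuous\<close>).

  The densities of the \<open>Q\<^sub>n\<close> and of \<open>R\<close> come from a Radon-Nikodym theorem for signed measures
  (\<open>signed_Radon_Nikodym\<close>), obtained from the Jordan decomposition and the theorem for
  finite measures.
\<close>

section \<open>Signed measures and their densities\<close>

lemma signed_measure_sums:
  assumes "Q \<in> signed_measures M" "range A \<subseteq> sets M" "disjoint_family (A :: nat \<Rightarrow> 'a set)"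
  shows "(\<lambda>i. Q (A i)) sums Q (\<Union>i. A i)"
  using assms by (auto simp: signed_measures_def)

lemma signed_measure_empty: "Q \<in> signed_measures M \<Longrightarrow> Q {} = 0"
  by (auto simp: signed_measures_def)

lemma signed_measure_Un:
  assumes Q: "Q \<in> signed_measures M" and A: "A \<in> sets M" and B: "B \<in> sets M"
    and disj: "A \<inter> B = {}"
  shows "Q (A \<union> B) = Q A + Q B"
proof -
  have "(\<lambda>i. Q (binaryset A B i)) sums Q (\<Union>i. binaryset A B i)"
    using A B disj by (intro signed_measure_sums[OF Q])
      (auto simp: range_binaryset_eq disjoint_family_on_def binaryset_def)
  moreover have "(\<lambda>i. Q (binaryset A B i)) sums (Q A + Q B)"
    by (rule binaryset_sums) (rule signed_measure_empty[OF Q])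
  ultimately show ?thesis
    by (simp add: UN_binaryset_eq sums_unique2)
qed

lemma signed_measure_Diff:
  assumes Q: "Q \<in> signed_measures M" and "A \<in> sets M" "B \<in> sets M" "B \<subseteq> A"
  shows "Q (A - B) = Q A - Q B"
  using signed_measure_Un[OF Q, of B "A - B"] assms by (simp add: Un_absorb1)

lemma signed_measure_uminus:
  "Q \<in> signed_measures M \<Longrightarrow> (\<lambda>A. - Q A) \<in> signed_measures M"
  by (auto simp: signed_measures_def intro: sums_minus)

text \<open>
  If \<open>Q\<close> is unbounded on the subsets of \<open>A\<close>, then \<open>A\<close> splits into two parts with
  \<open>\<bar>Q\<bar> \<ge> 1\<close> on both, and \<open>Q\<close> is again unbounded on the subsets of one of them.
  Cutting off the other part again and again leaves a disjoint sequence with \<open>\<bar>Q\<bar> \<ge> 1\<close>, against summability.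
\<close>

lemma signed_measure_bounded:
  assumes Q: "Q \<in> signed_measures M"
  obtains K where "0 \<le> K" "\<And>A. A \<in> sets M \<Longrightarrow> \<bar>Q A\<bar> \<le> K"
proof -
  define unb where "unb A \<longleftrightarrow> A \<in> sets M \<and> (\<forall>K. \<exists>B\<in>sets M. B \<subseteq> A \<and> K < \<bar>Q B\<bar>)" for A
  have unbD: "\<exists>B\<in>sets M. B \<subseteq> A \<and> K < \<bar>Q B\<bar>" if "unb A" for A K
    using that by (simp add: unb_def)
  have split: "\<exists>B. unb B \<and> B \<subseteq> A \<and> 1 \<le> \<bar>Q (A - B)\<bar>" if "unb A" for A
  proof -
    have A: "A \<in> sets M" using that by (simp add: unb_def)
    obtain B where B: "B \<in> sets M" "B \<subseteq> A" "\<bar>Q A\<bar> + 1 < \<bar>Q B\<bar>"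
      using unbD[OF \<open>unb A\<close>] by blast
    let ?C = "A - B"
    have C: "?C \<in> sets M" "A - ?C = B" using A B by auto
    have QC: "1 \<le> \<bar>Q ?C\<bar>" using signed_measure_Diff[OF Q A B(1,2)] B(3) by linarith
    have "unb B \<or> unb ?C"
    proof (rule ccontr)
      assume "\<not> (unb B \<or> unb ?C)"
      then obtain K L where K: "\<And>D. D \<in> sets M \<Longrightarrow> D \<subseteq> B \<Longrightarrow> \<bar>Q D\<bar> \<le> K"
        and L: "\<And>D. D \<in> sets M \<Longrightarrow> D \<subseteq> ?C \<Longrightarrow> \<bar>Q D\<bar> \<le> L"
        unfolding unb_def using B(1) C(1) by (meson not_le)
      obtain D where D: "D \<in> sets M" "D \<subseteq> A" "K + L < \<bar>Q D\<bar>"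
        using unbD[OF \<open>unb A\<close>] by blast
      have "D = D \<inter> B \<union> D \<inter> ?C" using D(2) by auto
      moreover have "Q (D \<inter> B \<union> D \<inter> ?C) = Q (D \<inter> B) + Q (D \<inter> ?C)"
        using D(1) B(1) C(1) by (intro signed_measure_Un[OF Q]) auto
      ultimately have "Q D = Q (D \<inter> B) + Q (D \<inter> ?C)"
        by metis
      moreover have "\<bar>Q (D \<inter> B)\<bar> \<le> K" "\<bar>Q (D \<inter> ?C)\<bar> \<le> L"
        using K L D(1) B(1) C(1) by auto
      ultimately show False using D(3) by linarith
    qed
    with B C QC show ?thesis by (metis Diff_subset less_eq_real_def abs_ge_zero add_increasing order_trans)
  qed
  have "\<not> unb (space M)"
  proof
    assume unb0: "unb (space M)"
    obtain S where S: "\<And>n::nat. unb (S n)" "\<And>n. S (Suc n) \<subseteq> S n \<and> 1 \<le> \<bar>Q (S n - S (Suc n))\<bar>"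
      using dependent_nat_choice[of "\<lambda>_ A. unb A" "\<lambda>_ A B. B \<subseteq> A \<and> 1 \<le> \<bar>Q (A - B)\<bar>"]
        unb0 split by metis
    have dec: "S n \<subseteq> S m" if "m \<le> n" for m n
      using S(2) by (intro lift_Suc_antimono_le[OF _ that]) auto
    have "disjoint_family (\<lambda>n. S n - S (Suc n))"
      unfolding disjoint_family_on_def
    proof (intro ballI impI)
      fix m n :: nat assume "m \<noteq> n"
      then show "(S m - S (Suc m)) \<inter> (S n - S (Suc n)) = {}"
        using dec[of "Suc m" n] dec[of "Suc n" m] by (cases m n rule: linorder_cases) auto
    qed
    moreover have "S n \<in> sets M" for n using S(1)[of n] by (simp add: unb_def)
    ultimately have "(\<lambda>n. Q (S n - S (Suc n))) sums Q (\<Union>n. S n - S (Suc n))"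
      by (intro signed_measure_sums[OF Q]) auto
    then have "(\<lambda>n. Q (S n - S (Suc n))) \<longlonglongrightarrow> 0"
      by (simp add: sums_iff summable_LIMSEQ_zero)
    from LIMSEQ_D[OF this zero_less_one] obtain n where "\<bar>Q (S n - S (Suc n))\<bar> < 1"
      by auto
    with S(2)[of n] show False by linarith
  qed
  then obtain K where "\<And>A. A \<in> sets M \<Longrightarrow> \<bar>Q A\<bar> \<le> K"
    unfolding unb_def by (meson not_le sets.sets_into_space sets.top)
  then show thesis using that[of "max K 0"] by fastforce
qed

lemma sets_pos_part_measure [simp]: "sets (pos_part_measure M Q) = sets M"
  unfolding pos_part_measure_def by (simp add: sets.sigma_sets_eq sets.space_closed)

lemma space_pos_part_measure [simp]: "space (pos_part_measure M Q) = space M"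
  unfolding pos_part_measure_def by (simp add: sets.space_closed)

text \<open>
  The set function that generates the positive part is a measure. It is superadditive because
  near-optimal subsets of disjoint sets can be united, and countably subadditive because every
  \<open>B \<subseteq> (\<Union>i. A i)\<close> is cut by the \<open>A i\<close> into pieces whose values sum to \<open>Q B\<close>.
\<close>

lemma emeasure_pos_part_measure:
  assumes Q: "Q \<in> signed_measures M" and A: "A \<in> sets M"
  shows "emeasure (pos_part_measure M Q) A = (SUP B\<in>{B \<in> sets M. B \<subseteq> A}. ennreal (Q B))"
proof -
  define f where "f A = (SUP B\<in>{B \<in> sets M. B \<subseteq> A}. ennreal (Q B))" for A
  have ne: "{B \<in> sets M. B \<subseteq> A} \<noteq> {}" for A by auto
  have upper: "ennreal (Q B) \<le> f A" if "B \<in> sets M" "B \<subseteq> A" for A B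
    unfolding f_def using that by (intro SUP_upper) auto
  have mono: "f A \<le> f B" if "A \<subseteq> B" for A B
    unfolding f_def using that by (intro SUP_subset_mono) auto
  have super: "f A + f B \<le> f (A \<union> B)" if disj: "A \<inter> B = {}" for A B
  proof -
    have "ennreal (Q C) + ennreal (Q D) \<le> f (A \<union> B)"
      if "C \<in> sets M" "C \<subseteq> A" "D \<in> sets M" "D \<subseteq> B" for C D
    proof -
      have "C \<inter> D = {}" using disj that by auto
      then have "Q (C \<union> D) = Q C + Q D" using signed_measure_Un[OF Q] that by auto
      then show ?thesis
        using upper[of C "A \<union> B"] upper[of D "A \<union> B"] upper[of "C \<union> D" "A \<union> B"] that
        by (cases "0 \<le> Q C"; cases "0 \<le> Q D") (auto simp: ennreal_neg ennreal_plus)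
    qed
    then have "f A + ennreal (Q D) \<le> f (A \<union> B)" if "D \<in> sets M" "D \<subseteq> B" for D
      unfolding f_def[of A] using that by (subst ennreal_SUP_add_left[symmetric]) (auto intro!: SUP_least ne)
    then show ?thesis
      unfolding f_def[of B] using ne by (simp add: ennreal_SUP_add_right SUP_le_iff)
  qed
  have "positive (sets M) f"
    using signed_measure_empty[OF Q] by (simp add: positive_def f_def)
  moreover have "countably_additive (sets M) f"
  proof (rule countably_additiveI)
    fix A :: "nat \<Rightarrow> 'a set"
    assume A: "range A \<subseteq> sets M" "disjoint_family A" "(\<Union>i. A i) \<in> sets M"
    show "(\<Sum>i. f (A i)) = f (\<Union>i. A i)"
    proof (rule antisym)
      have "(\<Sum>i<n. f (A i)) \<le> f (\<Union>i<n. A i)" for n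
      proof (induction n)
        case (Suc n)
        have "(\<Union>i<n. A i) \<inter> A n = {}"
          using disjoint_family_onD[OF A(2), of _ n] by (simp add: UN_iff disjoint_iff) (metis lessThan_iff less_irrefl)
        from super[OF this] Suc show ?case
          by (simp add: lessThan_Suc Un_commute add.commute) (meson add_left_mono order_trans)
      qed simp
      then show "(\<Sum>i. f (A i)) \<le> f (\<Union>i. A i)"
        by (intro suminf_le_const summableI) (meson mono UN_mono order_refl order_trans subset_UNIV)
      show "f (\<Union>i. A i) \<le> (\<Sum>i. f (A i))"
        unfolding f_def[of "\<Union>i. A i"]
      proof (rule SUP_least)
        fix B assume B: "B \<in> {B \<in> sets M. B \<subseteq> (\<Union>i. A i)}"
        have "(\<lambda>i. Q (B \<inter> A i)) sums Q (\<Union>i. B \<inter> A i)"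
          using A B by (intro signed_measure_sums[OF Q]) (auto simp: disjoint_family_on_def)
        moreover have "(\<Union>i. B \<inter> A i) = B" using B by auto
        ultimately have s: "(\<lambda>i. Q (B \<inter> A i)) sums Q B" by simp
        have "ennreal (\<Sum>i<n. Q (B \<inter> A i)) \<le> (\<Sum>i. f (A i))" for n
        proof -
          have "ennreal (\<Sum>i<n. Q (B \<inter> A i)) \<le> ennreal (\<Sum>i<n. max 0 (Q (B \<inter> A i)))"
            by (intro ennreal_leI sum_mono) auto
          also have "\<dots> = (\<Sum>i<n. ennreal (max 0 (Q (B \<inter> A i))))"
            by (subst sum_ennreal) auto
          also have "\<dots> \<le> (\<Sum>i<n. f (A i))"
            using A B by (intro sum_mono) (auto simp: max_def ennreal_neg intro!: upper)
          also have "\<dots> \<le> (\<Sum>i. f (A i))" by (intro sum_le_suminf) auto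
          finally show ?thesis .
        qed
        with s show "ennreal (Q B) \<le> (\<Sum>i. f (A i))"
          unfolding sums_def by (intro LIMSEQ_le_const2[OF tendsto_ennrealI]) auto
      qed
    qed
  qed
  ultimately show ?thesis
    using A unfolding pos_part_measure_def f_def[symmetric]
    by (intro emeasure_measure_of_sigma sets.sigma_algebra_axioms)
qed

lemma finite_measure_pos_part_measure:
  assumes Q: "Q \<in> signed_measures M"
  shows "finite_measure (pos_part_measure M Q)"
proof
  obtain K where K: "0 \<le> K" "\<And>A. A \<in> sets M \<Longrightarrow> \<bar>Q A\<bar> \<le> K"
    using signed_measure_bounded[OF Q] by blast
  have "emeasure (pos_part_measure M Q) (space M) \<le> ennreal K"
    using K by (subst emeasure_pos_part_measure[OF Q]) (auto intro!: SUP_least ennreal_leI simp: abs_le_iff)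
  then show "emeasure (pos_part_measure M Q) (space (pos_part_measure M Q)) \<noteq> \<infinity>"
    by (auto simp: top_unique)
qed

text \<open>
  Half of the Jordan decomposition; the other half is this one for \<open>- Q\<close>. For \<open>B \<subseteq> A\<close>, the excess
  \<open>Q B - Q A = - Q (A - B)\<close> is a value of \<open>- Q\<close> on a subset of \<open>A\<close>.
\<close>

lemma pos_part_measure_le:
  assumes Q: "Q \<in> signed_measures M" and A: "A \<in> sets M"
  shows "measure (pos_part_measure M Q) A - Q A \<le> measure (neg_part_measure M Q) A"
proof -
  interpret p: finite_measure "pos_part_measure M Q" by (rule finite_measure_pos_part_measure[OF Q])
  interpret n: finite_measure "neg_part_measure M Q"
    unfolding neg_part_measure_def
    by (rule finite_measure_pos_part_measure[OF signed_measure_uminus[OF Q]])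
  have neg: "- Q B \<le> measure (neg_part_measure M Q) A" if "B \<in> sets M" "B \<subseteq> A" for B
  proof -
    have "ennreal (- Q B) \<le> emeasure (neg_part_measure M Q) A"
      unfolding neg_part_measure_def
      using that A by (subst emeasure_pos_part_measure[OF signed_measure_uminus[OF Q]]) (auto intro!: SUP_upper)
    then show ?thesis by (simp add: n.emeasure_eq_measure)
  qed
  have pos: "0 \<le> measure (neg_part_measure M Q) A + Q A" using neg[OF A] by auto
  have "emeasure (pos_part_measure M Q) A \<le> ennreal (measure (neg_part_measure M Q) A + Q A)"
    unfolding emeasure_pos_part_measure[OF Q A]
  proof (intro SUP_least ennreal_leI)
    fix B assume "B \<in> {B \<in> sets M. B \<subseteq> A}"
    then show "Q B \<le> measure (neg_part_measure M Q) A + Q A"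
      using neg[of "A - B"] signed_measure_Diff[OF Q A, of B] A by auto
  qed
  then show ?thesis using pos by (simp add: p.emeasure_eq_measure)
qed

theorem signed_measure_Jordan:
  assumes Q: "Q \<in> signed_measures M" and A: "A \<in> sets M"
  shows "Q A = measure (pos_part_measure M Q) A - measure (neg_part_measure M Q) A"
  using pos_part_measure_le[OF Q A] pos_part_measure_le[OF signed_measure_uminus[OF Q] A]
  by (simp add: neg_part_measure_def)

lemma absolutely_continuous_pos_part_measure:
  assumes "Q \<in> ac_signed_measures P"
  shows "absolutely_continuous P (pos_part_measure P Q)"
proof -
  have "emeasure (pos_part_measure P Q) A = 0" if "A \<in> null_sets P" for A
  proof -
    have "Q B = 0" if "B \<in> sets P" "B \<subseteq> A" for B
      using assms \<open>A \<in> null_sets P\<close> that null_sets_subset[of A P B]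
      by (auto simp: ac_signed_measures_def)
    then show ?thesis
      using that assms by (subst emeasure_pos_part_measure) (auto simp: ac_signed_measures_def null_sets_def
        intro!: antisym SUP_least)
  qed
  then show ?thesis by (auto simp: absolutely_continuous_def null_sets_def)
qed

lemma pos_part_measure_density:
  assumes "finite_measure P" and Q: "Q \<in> ac_signed_measures P"
  obtains d where "d \<in> borel_measurable P" "\<And>x. 0 \<le> d x" "integrable P d"
    "pos_part_measure P Q = density P (\<lambda>x. ennreal (d x))"
proof -
  interpret P: finite_measure P by fact
  let ?N = "pos_part_measure P Q"
  have sm: "Q \<in> signed_measures P" using Q by (simp add: ac_signed_measures_def)
  interpret N: finite_measure ?N by (rule finite_measure_pos_part_measure[OF sm])
  note ac = absolutely_continuous_pos_part_measure[OF Q]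
  obtain d where d: "d \<in> borel_measurable P" "AE x in P. RN_deriv P ?N x = ennreal (d x)"
    "\<And>x. 0 \<le> d x"
    using P.real_RN_deriv[OF N.finite_measure_axioms ac sets_pos_part_measure] by metis
  have "?N = density P (RN_deriv P ?N)"
    using P.density_RN_deriv[OF ac sets_pos_part_measure] by simp
  also have "\<dots> = density P (\<lambda>x. ennreal (d x))"
    using d by (intro density_cong) auto
  finally have N: "?N = density P (\<lambda>x. ennreal (d x))" .
  have "(\<integral>\<^sup>+x. ennreal (d x) \<partial>P) = emeasure ?N (space P)"
    using d unfolding N by (subst emeasure_density) (auto intro!: nn_integral_cong)
  then have "integrable P d"
    using d N.emeasure_finite[of "space P"] by (intro integrableI_nonneg) (auto simp: less_top[symmetric])
  with d N that show thesis by blast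
qed

lemma integrable_bounded_mult:
  fixes f h :: "'a \<Rightarrow> real"
  assumes h: "integrable M h" and f: "f \<in> borel_measurable M" "bounded (f ` space M)"
  shows "integrable M (\<lambda>x. f x * h x)"
proof -
  obtain K where K: "\<And>x. x \<in> space M \<Longrightarrow> \<bar>f x\<bar> \<le> K"
    using f(2) by (auto simp: bounded_iff)
  show ?thesis
  proof (rule Bochner_Integration.integrable_bound[where f="\<lambda>x. K * h x"])
    show "AE x in M. norm (f x * h x) \<le> norm (K * h x)"
    proof (rule AE_I2)
      fix x assume "x \<in> space M"
      then have "\<bar>f x\<bar> \<le> \<bar>K\<bar>" using K[of x] by linarith
      then show "norm (f x * h x) \<le> norm (K * h x)"
        by (simp add: abs_mult mult_right_mono)
    qed
  qed (use h f in auto)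
qed

text \<open>
  The densities of the positive and of the negative part are subtracted. The same two densities
  evaluate \<^const>\<open>signed_integral\<close>, which is defined through these parts.
\<close>

theorem signed_Radon_Nikodym:
  assumes "finite_measure P" and Q: "Q \<in> ac_signed_measures P"
  obtains g where "integrable P g"
    "\<And>A. A \<in> sets P \<Longrightarrow> Q A = set_lebesgue_integral P A g"
    "\<And>f. f \<in> borel_measurable P \<Longrightarrow> bounded (f ` space P) \<Longrightarrow>
       signed_integral P Q f = (\<integral>x. f x * g x \<partial>P)"
proof -
  have sm: "Q \<in> signed_measures P" using Q by (simp add: ac_signed_measures_def)
  have "(\<lambda>A. - Q A) \<in> ac_signed_measures P"
    using Q signed_measure_uminus by (auto simp: ac_signed_measures_def)
  from pos_part_measure_density[OF assms(1) this]
  obtain e where e: "e \<in> borel_measurable P" "\<And>x. 0 \<le> e x" "integrable P e"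
    "neg_part_measure P Q = density P (\<lambda>x. ennreal (e x))"
    unfolding neg_part_measure_def by blast
  obtain d where d: "d \<in> borel_measurable P" "\<And>x. 0 \<le> d x" "integrable P d"
    "pos_part_measure P Q = density P (\<lambda>x. ennreal (d x))"
    using pos_part_measure_density[OF assms] by blast
  have meas: "measure (density P (\<lambda>x. ennreal (h x))) A = set_lebesgue_integral P A h"
    if "A \<in> sets P" "h \<in> borel_measurable P" "\<And>x. 0 \<le> h x" "integrable P h" for A h
  proof -
    have "emeasure (density P (\<lambda>x. ennreal (h x))) A = (\<integral>\<^sup>+x. ennreal (indicator A x * h x) \<partial>P)"
      using that by (subst emeasure_density) (auto intro!: nn_integral_cong split: split_indicator)
    also have "\<dots> = ennreal (set_lebesgue_integral P A h)"
      using that integrable_mult_indicator[of A P h] unfolding set_lebesgue_integral_def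
      by (subst nn_integral_eq_integral) auto
    finally show ?thesis
      using that by (simp add: measure_def set_lebesgue_integral_def)
  qed
  have "Q A = set_lebesgue_integral P A (\<lambda>x. d x - e x)" if A: "A \<in> sets P" for A
    using A d(1-3) e(1-3) integrable_mult_indicator[of A P d] integrable_mult_indicator[of A P e]
    unfolding signed_measure_Jordan[OF sm A] d(4) e(4)
    by (simp add: meas set_integral_diff(2) set_integrable_def)
  moreover have "signed_integral P Q f = (\<integral>x. f x * (d x - e x) \<partial>P)"
    if f: "f \<in> borel_measurable P" "bounded (f ` space P)" for f
  proof -
    note int = integrable_bounded_mult[OF _ f]
    show ?thesis
      unfolding signed_integral_def d(4) e(4)
      using d e f int[OF d(3)] int[OF e(3)]
      by (simp add: integral_real_density right_diff_distrib mult.commute)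
  qed
  ultimately show thesis using d e that[of "\<lambda>x. d x - e x"] by simp
qed

text \<open>
  Existence of a density gives the choice in \<^const>\<open>signed_RN_deriv\<close> its defining property, and two
  integrable densities of the same signed measure agree almost everywhere.
\<close>

lemma
  assumes "finite_measure P" and Q: "Q \<in> ac_signed_measures P"
  shows integrable_signed_RN_deriv: "integrable P (signed_RN_deriv P Q)"
    and signed_measure_eq_set_integral:
      "A \<in> sets P \<Longrightarrow> Q A = set_lebesgue_integral P A (signed_RN_deriv P Q)"
    and signed_integral_eq_integral:
      "f \<in> borel_measurable P \<Longrightarrow> bounded (f ` space P) \<Longrightarrow>
         signed_integral P Q f = (\<integral>x. f x * signed_RN_deriv P Q x \<partial>P)"
proof -
  obtain g where g: "integrable P g" "\<And>A. A \<in> sets P \<Longrightarrow> Q A = set_lebesgue_integral P A g"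
    "\<And>f. f \<in> borel_measurable P \<Longrightarrow> bounded (f ` space P) \<Longrightarrow>
       signed_integral P Q f = (\<integral>x. f x * g x \<partial>P)"
    using signed_Radon_Nikodym[OF assms] by metis
  have ex: "\<exists>g. integrable P g \<and> (\<forall>A\<in>sets P. Q A = set_lebesgue_integral P A g)"
    using g(1,2) by blast
  note * = someI_ex[OF ex, folded signed_RN_deriv_def]
  from * show int: "integrable P (signed_RN_deriv P Q)" by blast
  from * show eq: "A \<in> sets P \<Longrightarrow> Q A = set_lebesgue_integral P A (signed_RN_deriv P Q)" for A
    by blast
  have "AE x in P. g x = signed_RN_deriv P Q x"
    using * g by (intro density_unique_real) metis+
  then show "signed_integral P Q f = (\<integral>x. f x * signed_RN_deriv P Q x \<partial>P)"
    if "f \<in> borel_measurable P" "bounded (f ` space P)"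
    using that g(1) int unfolding g(3)[OF that] by (intro integral_cong_AE) auto
qed

section \<open>Closed convex functions as countable suprema of affine functions\<close>

text \<open>
  Convexity handles every point beyond which, seen from 1, the domain still continues: \<open>x\<close> is then a
  convex combination of a point nearer to 1 and a fixed point of the domain, the weight of the latter
  tending to 0. Otherwise \<open>x\<close> is a finite endpoint of the domain, and the bound passes to the limit
  because \<open>\<phi>\<close> is closed there.
\<close>

lemma radial_lower_semicontinuity:
  assumes \<phi>: "divergence_function \<phi>"
    and le: "\<And>\<theta>. 0 < \<theta> \<Longrightarrow> \<theta> < 1 \<Longrightarrow> \<phi> (1 + \<theta> * (x - 1)) \<le> ennreal t"
  shows "\<phi> x \<le> ennreal t"
proof (cases "x = 1")
  case True
  then show ?thesis using \<phi> by (simp add: divergence_function_def)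
next
  case x1: False
  have conv: "\<phi> ((1 - s) * y + s * z) \<le> ennreal (1 - s) * \<phi> y + ennreal s * \<phi> z"
    if "0 \<le> s" "s \<le> 1" for s y z
    using \<phi> that by (simp add: divergence_function_def convex_fun_def)
  have lim1: "((\<lambda>\<theta>. 1 + \<theta> * (x - 1)) \<longlongrightarrow> x) (at_left 1)"
    by (auto intro!: tendsto_eq_intros)
  have ev: "\<forall>\<^sub>F \<theta> in at_left 1. 0 < \<theta> \<and> \<theta> < (1::real)"
    using eventually_at_left_real[of 0 1] by (auto elim: eventually_mono)
  have dom: "1 + \<theta> * (x - 1) \<in> eff_domain \<phi>" if "0 < \<theta>" "\<theta> < 1" for \<theta>
    using le[OF that] by (auto simp: eff_domain_def less_top[symmetric] top_unique)
  show ?thesis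
  proof (cases "\<exists>\<eta>>1. 1 + \<eta> * (x - 1) \<in> eff_domain \<phi>")
    case True
    then obtain \<eta> where \<eta>: "1 < \<eta>" "\<phi> (1 + \<eta> * (x - 1)) < \<top>" by (auto simp: eff_domain_def)
    define c where "c = enn2real (\<phi> (1 + \<eta> * (x - 1)))"
    have c: "\<phi> (1 + \<eta> * (x - 1)) = ennreal c" "0 \<le> c" using \<eta>(2) by (auto simp: c_def)
    have "\<phi> x \<le> ennreal t + ennreal ((1 - \<theta>) / (\<eta> - \<theta>) * c)" if \<theta>: "0 < \<theta>" "\<theta> < 1" for \<theta>
    proof -
      \<comment> \<open>The weight that writes \<open>x\<close> as a convex combination of the points with parameters \<open>\<theta>\<close> and \<open>\<eta>\<close>.\<close>
      define s where "s = (1 - \<theta>) / (\<eta> - \<theta>)"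
      have s: "0 \<le> s" "s \<le> 1" "s * (\<eta> - \<theta>) = 1 - \<theta>" using \<theta> \<eta>(1) by (auto simp: s_def field_simps)
      have "(1 - s) * (1 + \<theta> * (x - 1)) + s * (1 + \<eta> * (x - 1)) = 1 + (\<theta> + s * (\<eta> - \<theta>)) * (x - 1)"
        by (simp add: algebra_simps)
      also have "\<dots> = x" by (simp add: s(3))
      finally have "\<phi> x \<le> ennreal (1 - s) * \<phi> (1 + \<theta> * (x - 1)) + ennreal s * ennreal c"
        using conv[OF s(1,2), of "1 + \<theta> * (x - 1)" "1 + \<eta> * (x - 1)"] c by simp
      also have "\<dots> \<le> 1 * ennreal t + ennreal (s * c)"
        using s c by (intro add_mono mult_mono le[OF \<theta>]) (auto simp: ennreal_mult ennreal_le_1)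
      finally show ?thesis by (simp add: s_def)
    qed
    then have "\<forall>\<^sub>F \<theta> in at_left 1. \<phi> x \<le> ennreal t + ennreal ((1 - \<theta>) / (\<eta> - \<theta>) * c)"
      using ev by (auto elim: eventually_mono)
    moreover have "((\<lambda>\<theta>. ennreal t + ennreal ((1 - \<theta>) / (\<eta> - \<theta>) * c)) \<longlongrightarrow> ennreal t + ennreal 0) (at_left 1)"
      using \<eta>(1) by (intro tendsto_add tendsto_ennrealI tendsto_const) (auto intro!: tendsto_eq_intros)
    ultimately have "\<phi> x \<le> ennreal t + ennreal 0"
      by (intro tendsto_lowerbound) auto
    then show ?thesis by simp
  next
    case False
    have out: "y \<notin> eff_domain \<phi>" if "(y - x) * (x - 1) > 0" for y
    proof -
      have "y = 1 + ((y - 1) / (x - 1)) * (x - 1)" using x1 by simp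
      moreover have "(y - 1) / (x - 1) > 1"
        using that x1 by (cases "x > 1") (auto simp: less_divide_eq zero_less_mult_iff)
      ultimately show ?thesis using False by metis
    qed
    have lim2: "(\<phi> \<longlongrightarrow> \<phi> x) (if x > 1 then at_left x else at_right x)"
    proof (cases "x > 1")
      case True
      have "upper_endpoint \<phi> = ereal x"
        unfolding upper_endpoint_def
      proof (rule antisym)
        show "(SUP y\<in>eff_domain \<phi>. ereal y) \<le> ereal x"
          using out True by (intro SUP_least) (force simp: zero_less_mult_iff not_le)
        have "\<forall>\<^sub>F \<theta> in at_left 1. ereal (1 + \<theta> * (x - 1)) \<le> (SUP y\<in>eff_domain \<phi>. ereal y)"
          using ev by eventually_elim (auto intro: SUP_upper dom)
        moreover have "((\<lambda>\<theta>. ereal (1 + \<theta> * (x - 1))) \<longlongrightarrow> ereal x) (at_left 1)"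
          using lim1 by simp
        ultimately show "ereal x \<le> (SUP y\<in>eff_domain \<phi>. ereal y)"
          by (intro tendsto_upperbound) auto
      qed
      with True \<phi> show ?thesis by (auto simp: divergence_function_def closed_fun_def)
    next
      case 2: False
      have "lower_endpoint \<phi> = ereal x"
        unfolding lower_endpoint_def
      proof (rule antisym)
        show "ereal x \<le> (INF y\<in>eff_domain \<phi>. ereal y)"
          using out 2 x1 by (intro INF_greatest) (force simp: zero_less_mult_iff not_le)
        have "\<forall>\<^sub>F \<theta> in at_left 1. (INF y\<in>eff_domain \<phi>. ereal y) \<le> ereal (1 + \<theta> * (x - 1))"
          using ev by eventually_elim (auto intro: INF_lower dom)
        moreover have "((\<lambda>\<theta>. ereal (1 + \<theta> * (x - 1))) \<longlongrightarrow> ereal x) (at_left 1)"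
          using lim1 by simp
        ultimately show "(INF y\<in>eff_domain \<phi>. ereal y) \<le> ereal x"
          by (intro tendsto_lowerbound) auto
      qed
      with 2 \<phi> show ?thesis by (auto simp: divergence_function_def closed_fun_def)
    qed
    have "filterlim (\<lambda>\<theta>. 1 + \<theta> * (x - 1)) (if x > 1 then at_left x else at_right x) (at_left 1)"
    proof (cases "x > 1")
      case True
      have "\<forall>\<^sub>F \<theta> in at_left 1. 1 + \<theta> * (x - 1) \<in> {..<x} - {x}"
        using ev
      proof eventually_elim
        case (elim \<theta>)
        have "\<theta> * (x - 1) < 1 * (x - 1)" using elim True by (intro mult_strict_right_mono) auto
        then show ?case by auto
      qed
      with lim1 True show ?thesis by (auto simp: filterlim_at elim: eventually_mono)
    next
      case 2: False
      have "\<forall>\<^sub>F \<theta> in at_left 1. 1 + \<theta> * (x - 1) \<in> {x<..} - {x}"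
        using ev
      proof eventually_elim
        case (elim \<theta>)
        have "\<theta> * (1 - x) < 1 * (1 - x)" using elim 2 x1 by (intro mult_strict_right_mono) auto
        then show ?case by (auto simp: algebra_simps)
      qed
      with lim1 2 show ?thesis by (auto simp: filterlim_at elim: eventually_mono)
    qed
    from filterlim_compose[OF lim2 this]
    have "((\<lambda>\<theta>. \<phi> (1 + \<theta> * (x - 1))) \<longlongrightarrow> \<phi> x) (at_left 1)" .
    moreover have "\<forall>\<^sub>F \<theta> in at_left 1. \<phi> (1 + \<theta> * (x - 1)) \<le> ennreal t"
      using ev by eventually_elim (auto intro: le)
    ultimately show ?thesis by (intro tendsto_upperbound) auto
  qed
qed

text \<open>
  Since \<^const>\<open>ennreal\<close> sends negative numbers to 0, negative heights have to be excluded explicitly.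
\<close>

definition epigraph :: "(real \<Rightarrow> ennreal) \<Rightarrow> (real \<times> real) set" where
  "epigraph \<phi> = {p. 0 \<le> snd p \<and> \<phi> (fst p) \<le> ennreal (snd p)}"

text \<open>
  Let \<open>(y\<^sub>n, s\<^sub>n)\<close> in the epigraph tend to \<open>(x, t)\<close>. A point strictly between 1 and \<open>x\<close> lies
  eventually between 1 and \<open>y\<^sub>n\<close>, and \<open>\<phi>\<close> never decreases away from its zero at 1, so
  the value there is at most \<open>t\<close>. Radial lower semicontinuity carries this bound to \<open>x\<close>.
\<close>

lemma closed_epigraph:
  assumes \<phi>: "divergence_function \<phi>"
  shows "closed (epigraph \<phi>)"
  unfolding closed_sequential_limits
proof (intro allI impI, elim conjE)
  fix X :: "nat \<Rightarrow> real \<times> real" and p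
  assume X: "\<forall>n. X n \<in> epigraph \<phi>" and "X \<longlonglongrightarrow> p"
  have conv: "\<forall>x y. \<forall>t\<in>{0..1}. \<phi> ((1 - t) * x + t * y) \<le> ennreal (1 - t) * \<phi> x + ennreal t * \<phi> y"
    using \<phi> by (simp add: divergence_function_def convex_fun_def)
  obtain x t where p: "p = (x, t)" by (cases p)
  define y s where "y n = fst (X n)" and "s n = snd (X n)" for n
  have y: "y \<longlonglongrightarrow> x" and s: "s \<longlonglongrightarrow> t"
    using tendsto_fst[OF \<open>X \<longlonglongrightarrow> p\<close>] tendsto_snd[OF \<open>X \<longlonglongrightarrow> p\<close>] by (auto simp: y_def[abs_def] s_def[abs_def] p)
  have Xn: "0 \<le> s n" "\<phi> (y n) \<le> ennreal (s n)" for n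
    using X by (auto simp: epigraph_def y_def s_def)
  have t: "0 \<le> t" using Xn(1) by (intro LIMSEQ_le_const[OF s]) auto
  have "\<phi> x \<le> ennreal t"
  proof (cases "x = 1")
    case True
    then show ?thesis using \<phi> by (simp add: divergence_function_def)
  next
    case False
    show ?thesis
    proof (rule radial_lower_semicontinuity[OF \<phi>])
      fix \<theta> :: real assume \<theta>: "0 < \<theta>" "\<theta> < 1"
      have "(\<lambda>n. \<theta> * (x - 1) / (y n - 1)) \<longlonglongrightarrow> \<theta>"
        using False by (auto intro!: tendsto_eq_intros y)
      then have "\<forall>\<^sub>F n in sequentially. \<theta> * (x - 1) / (y n - 1) < 1 \<and> 0 < \<theta> * (x - 1) / (y n - 1)"
        using \<theta> by (auto intro: eventually_conj order_tendstoD)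
      then have "\<forall>\<^sub>F n in sequentially. \<phi> (1 + \<theta> * (x - 1)) \<le> ennreal (s n)"
      proof eventually_elim
        case (elim n)
        define r where "r = \<theta> * (x - 1) / (y n - 1)"
        have r: "0 < r" "r < 1" using elim by (auto simp: r_def)
        then have "r * (y n - 1) = \<theta> * (x - 1)" by (auto simp: r_def)
        then have "1 + \<theta> * (x - 1) = (1 - r) * 1 + r * y n" by (simp add: algebra_simps)
        moreover have "\<phi> ((1 - r) * 1 + r * y n) \<le> ennreal (1 - r) * \<phi> 1 + ennreal r * \<phi> (y n)"
          using conv[rule_format, of r 1 "y n"] r by simp
        ultimately have "\<phi> (1 + \<theta> * (x - 1)) \<le> ennreal r * \<phi> (y n)"
          using \<phi> by (metis add.left_neutral divergence_function_def mult_zero_right)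
        also have "\<dots> \<le> 1 * ennreal (s n)"
          using r Xn by (intro mult_mono) (auto simp: ennreal_le_1)
        finally show ?case by simp
      qed
      then show "\<phi> (1 + \<theta> * (x - 1)) \<le> ennreal t"
        by (intro tendsto_lowerbound[OF tendsto_ennrealI[OF s]]) auto
    qed
  qed
  with t show "p \<in> epigraph \<phi>" by (simp add: epigraph_def p)
qed

lemma convex_epigraph:
  assumes "convex_fun \<phi>"
  shows "convex (epigraph \<phi>)"
proof (rule convexI)
  fix p q :: "real \<times> real" and v w :: real
  assume p: "p \<in> epigraph \<phi>" and q: "q \<in> epigraph \<phi>" and vw: "0 \<le> v" "0 \<le> w" "v + w = 1"
  have v: "v = 1 - w" using vw by simp
  have "\<phi> (v * fst p + w * fst q) \<le> ennreal v * \<phi> (fst p) + ennreal w * \<phi> (fst q)"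
    using assms vw unfolding convex_fun_def v by auto
  also have "\<dots> \<le> ennreal v * ennreal (snd p) + ennreal w * ennreal (snd q)"
    using p q by (intro add_mono mult_left_mono) (auto simp: epigraph_def)
  also have "\<dots> = ennreal (v * snd p + w * snd q)"
    using p q vw by (simp add: epigraph_def ennreal_mult ennreal_plus)
  finally show "v *\<^sub>R p + w *\<^sub>R q \<in> epigraph \<phi>"
    using p q vw by (simp add: epigraph_def)
qed

text \<open>
  Any point below the graph is separated from the epigraph by a line. If the line is
  not vertical, it is the graph of an affine minorant. If it is vertical, then \<open>\<phi> x = \<infinity>\<close>, and the line
  is the zero set of an affine function that is negative on the domain and positive at \<open>x\<close>; since
  \<open>\<phi>\<close> is nonnegative, all positive multiples of that function are minorants.
\<close>

lemma affine_minorant: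
  assumes \<phi>: "divergence_function \<phi>" and t: "0 \<le> t" "ennreal t < \<phi> x"
  obtains a b where "\<And>y. ennreal (a + b * y) \<le> \<phi> y" "t < a + b * x"
proof -
  have "(x, t) \<notin> epigraph \<phi>" using t by (simp add: epigraph_def)
  moreover have "convex (epigraph \<phi>)"
    using \<phi> by (intro convex_epigraph) (simp add: divergence_function_def)
  ultimately obtain v \<beta> where v: "v \<bullet> (x, t) < \<beta>" "\<And>p. p \<in> epigraph \<phi> \<Longrightarrow> \<beta> < v \<bullet> p"
    using separating_hyperplane_closed_point[OF _ closed_epigraph[OF \<phi>]] by blast
  obtain v1 v2 where v12: "v = (v1, v2)" by (cases v)
  have sep: "v1 * x + v2 * t < \<beta>" using v(1) by (simp add: v12)
  have epi: "\<beta> < v1 * y + v2 * r" if "\<phi> y \<le> ennreal r" "0 \<le> r" for y r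
    using v(2)[of "(y, r)"] that by (simp add: v12 epigraph_def)
  have "0 \<le> v2"
  proof (rule ccontr)
    assume neg: "\<not> 0 \<le> v2"
    \<comment> \<open>The epigraph contains all points above \<open>(1, 0)\<close>; this one is high enough to violate the separation.\<close>
    define r where "r = max 0 ((\<beta> - v1) / v2)"
    have "\<beta> < v1 * 1 + v2 * r" using \<phi> by (intro epi) (auto simp: r_def divergence_function_def)
    moreover have "v2 * r \<le> \<beta> - v1" using neg by (auto simp: r_def max_def field_simps)
    ultimately show False by simp
  qed
  show thesis
  proof (cases "v2 = 0")
    case False
    with \<open>0 \<le> v2\<close> have v2: "0 < v2" by simp
    show thesis
    proof (rule that[of "\<beta> / v2" "- v1 / v2"])
      fix y
      show "ennreal (\<beta> / v2 + - v1 / v2 * y) \<le> \<phi> y"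
      proof (cases "\<phi> y")
        case (real r)
        then show ?thesis using epi[of y r] v2 by (auto intro!: ennreal_leI simp: field_simps)
      qed simp
    next
      show "t < \<beta> / v2 + - v1 / v2 * x" using sep v2 by (simp add: field_simps)
    qed
  next
    case True
    \<comment> \<open>The multiple that takes the value \<open>t + 1\<close> at \<open>x\<close>.\<close>
    define k where "k = (t + 1) / (\<beta> - v1 * x)"
    have k: "0 < k" "k * (\<beta> - v1 * x) = t + 1" using sep t True by (auto simp: k_def)
    show thesis
    proof (rule that[of "k * \<beta>" "- (k * v1)"])
      fix y
      show "ennreal (k * \<beta> + - (k * v1) * y) \<le> \<phi> y"
      proof (cases "\<phi> y")
        case (real r)
        have "k * (\<beta> - v1 * y) \<le> 0"
          using epi[of y r] real k True by (intro mult_nonneg_nonpos) auto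
        then show ?thesis by (simp add: ennreal_neg algebra_simps)
      qed simp
    next
      show "t < k * \<beta> + - (k * v1) * x" using k(2) by (simp add: algebra_simps)
    qed
  qed
qed

text \<open>
  The open half planes below the affine minorants cover everything strictly below the graph. The plane
  is Lindelof, so countably many of them do. The zero function is added to make the family
  nonempty, so that the natural numbers can enumerate it.
\<close>

theorem countable_affine_representation:
  assumes \<phi>: "divergence_function \<phi>"
  obtains a b :: "nat \<Rightarrow> real" where "\<And>y. \<phi> y = (SUP i. ennreal (a i + b i * y))"
proof -
  define L where "L = {(a, b). \<forall>y. ennreal (a + b * y) \<le> \<phi> y}"
  define below where "below = (\<lambda>(a, b). {(x, t). t < a + b * (x::real)})"
  have "open (below l)" for l
  proof -
    have "below l = {p. snd p < fst l + snd l * fst p}" by (auto simp: below_def split: prod.splits)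
    then show ?thesis by (auto intro!: open_Collect_less continuous_intros)
  qed
  then obtain F where F: "F \<subseteq> below ` L" "countable F" "\<Union>F = \<Union>(below ` L)"
    using Lindelof[of "below ` L"] by (metis imageE)
  then obtain L' where L': "L' \<subseteq> L" "countable L'" "F = below ` L'"
    by (metis countable_subset_image)
  have L0: "(0, 0) \<in> L" by (simp add: L_def)
  let ?L = "insert (0, 0) L'"
  define l where "l = from_nat_into ?L"
  have range_l: "range l = ?L" unfolding l_def using L'(2) by (intro range_from_nat_into) auto
  show thesis
  proof (rule that[of "\<lambda>i. fst (l i)" "\<lambda>i. snd (l i)"], rule antisym)
    fix y
    have "l i \<in> L" for i using rangeI[of l i] L0 L'(1) unfolding range_l by auto
    then show "(SUP i. ennreal (fst (l i) + snd (l i) * y)) \<le> \<phi> y"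
      by (intro SUP_least) (auto simp: L_def split_beta)
    show "\<phi> y \<le> (SUP i. ennreal (fst (l i) + snd (l i) * y))"
    proof (rule dense_le)
      fix c assume "c < \<phi> y"
      then obtain t where t: "c = ennreal t" "0 \<le> t" by (cases c) auto
      obtain a b where ab: "\<And>y. ennreal (a + b * y) \<le> \<phi> y" "t < a + b * y"
        using affine_minorant[OF \<phi> t(2), of y] \<open>c < \<phi> y\<close> t by blast
      then have "(a, b) \<in> L" "(y, t) \<in> below (a, b)" by (auto simp: L_def below_def)
      then have "(y, t) \<in> \<Union>(below ` L')" using F(3) L'(3) by blast
      then obtain l' where l': "l' \<in> L'" "(y, t) \<in> below l'" by blast
      then obtain i where "l i = l'" using range_l by (metis insertCI rangeE)
      with l'(2) have "t < fst (l i) + snd (l i) * y" by (auto simp: below_def split: prod.splits)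
      then show "c \<le> (SUP i. ennreal (fst (l i) + snd (l i) * y))"
        unfolding t(1) by (intro SUP_upper2[of i] ennreal_leI) auto
    qed
  qed
qed

section \<open>Lower semicontinuity of convex integral functionals\<close>

lemma Liminf_add_ennreal:
  fixes f g :: "'i \<Rightarrow> ennreal"
  shows "Liminf F f + Liminf F g \<le> Liminf F (\<lambda>n. f n + g n)"
proof (cases "F = bot")
  case False
  have "(SUP P\<in>{P. eventually P F}. INF n\<in>Collect P. f n) + Liminf F g \<le> Liminf F (\<lambda>n. f n + g n)"
  proof (subst ennreal_SUP_add_left[symmetric])
    show "{P. eventually P F} \<noteq> {}" by (auto intro: exI[of _ "\<lambda>_. True"])
    show "(SUP P\<in>{P. eventually P F}. (INF n\<in>Collect P. f n) + Liminf F g) \<le> Liminf F (\<lambda>n. f n + g n)"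
    proof (rule SUP_least)
      fix P assume "P \<in> {P. eventually P F}"
      then have P: "eventually P F" by simp
      have "(INF n\<in>Collect P. f n) + Liminf F g = Liminf F (\<lambda>n. (INF n\<in>Collect P. f n) + g n)"
        using False by (simp add: Liminf_const_add)
      also have "\<dots> \<le> Liminf F (\<lambda>n. f n + g n)"
        using P by (intro Liminf_mono) (auto elim!: eventually_mono intro!: add_right_mono INF_lower)
      finally show "(INF n\<in>Collect P. f n) + Liminf F g \<le> Liminf F (\<lambda>n. f n + g n)" .
    qed
  qed
  then show ?thesis by (simp add: Liminf_def[of F f])
qed simp

text \<open>
  For finitely many functions, cut the set into pieces on which one of them is the largest, apply the
  bound for that function on its piece, and recombine with superadditivity. Monotone convergence
  does the rest.
\<close>

lemma nn_integral_SUP_le_superadditive: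
  fixes h :: "nat \<Rightarrow> 'a \<Rightarrow> ennreal" and K :: "'a set \<Rightarrow> ennreal"
  assumes meas [measurable]: "\<And>i. h i \<in> borel_measurable M"
    and super: "\<And>A B. A \<in> sets M \<Longrightarrow> B \<in> sets M \<Longrightarrow> A \<inter> B = {} \<Longrightarrow> K A + K B \<le> K (A \<union> B)"
    and le: "\<And>i A. A \<in> sets M \<Longrightarrow> (\<integral>\<^sup>+x\<in>A. h i x \<partial>M) \<le> K A"
  shows "(\<integral>\<^sup>+x. (SUP i. h i x) \<partial>M) \<le> K (space M)"
proof -
  define m where "m k x = (SUP i\<in>{..k}. h i x)" for k x
  have [measurable]: "m k \<in> borel_measurable M" for k unfolding m_def by measurable
  have m_Suc: "m (Suc k) x = max (h (Suc k) x) (m k x)" for k x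
    unfolding m_def by (simp add: atMost_Suc sup_max)
  have "(\<integral>\<^sup>+x\<in>A. m k x \<partial>M) \<le> K A" if "A \<in> sets M" for k A
    using that
  proof (induction k arbitrary: A)
    case 0
    then show ?case using le by (simp add: m_def)
  next
    case (Suc k)
    define B where "B = {x \<in> space M. m k x < h (Suc k) x}"
    have [measurable]: "B \<in> sets M" "A \<in> sets M" using Suc.prems by (auto simp: B_def)
    have "(\<integral>\<^sup>+x\<in>A. m (Suc k) x \<partial>M) = (\<integral>\<^sup>+x. h (Suc k) x * indicator (A \<inter> B) x + m k x * indicator (A - B) x \<partial>M)"
      by (intro nn_integral_cong) (auto simp: m_Suc B_def max_def split: split_indicator)
    also have "\<dots> = (\<integral>\<^sup>+x\<in>A \<inter> B. h (Suc k) x \<partial>M) + (\<integral>\<^sup>+x\<in>A - B. m k x \<partial>M)"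
      by (intro nn_integral_add) auto
    also have "\<dots> \<le> K (A \<inter> B) + K (A - B)"
      by (intro add_mono le Suc.IH) auto
    also have "\<dots> \<le> K (A \<inter> B \<union> (A - B))"
      by (intro super) auto
    also have "A \<inter> B \<union> (A - B) = A" by auto
    finally show ?case .
  qed
  from this[OF sets.top] have fin: "(\<integral>\<^sup>+x. m k x \<partial>M) \<le> K (space M)" for k
    by simp
  have "(SUP i. h i x) = (SUP k. m k x)" for x
    by (rule antisym) (auto simp: m_def intro!: SUP_least intro: SUP_upper2 SUP_upper)
  then have "(\<integral>\<^sup>+x. (SUP i. h i x) \<partial>M) = (\<integral>\<^sup>+x. (SUP k. m k x) \<partial>M)" by simp
  also have "\<dots> = (SUP k. \<integral>\<^sup>+x. m k x \<partial>M)"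
    by (intro nn_integral_monotone_convergence_SUP) (auto simp: incseq_Suc_iff le_fun_def m_Suc)
  also have "\<dots> \<le> K (space M)" using fin by (intro SUP_least)
  finally show ?thesis .
qed

text \<open>
  The superadditive set function is \<open>K A\<close>, the lower limit of \<open>\<integral>\<^sub>A \<phi>(g\<^sub>n) dP\<close>. It dominates the
  integral over \<open>A\<close> of each affine function of \<open>h\<close> because setwise convergence passes to
  integrals of affine functions, and these are minorants of \<open>\<phi>\<close>.
\<close>

theorem convex_integral_lower_semicontinuous:
  fixes F :: "'i filter" and g :: "'i \<Rightarrow> 'a \<Rightarrow> real" and a b :: "nat \<Rightarrow> real"
  assumes "finite_measure P"
    and \<phi>: "\<And>y. \<phi> y = (SUP i. ennreal (a i + b i * y))"
    and g: "\<And>n. integrable P (g n)" and h: "integrable P h"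
    and lim: "\<And>A. A \<in> sets P \<Longrightarrow>
      ((\<lambda>n. set_lebesgue_integral P A (g n)) \<longlongrightarrow> set_lebesgue_integral P A h) F"
    and F: "F \<noteq> bot"
  shows "(\<integral>\<^sup>+x. \<phi> (h x) \<partial>P) \<le> Liminf F (\<lambda>n. \<integral>\<^sup>+x. \<phi> (g n x) \<partial>P)"
proof -
  interpret finite_measure P by fact
  have [measurable]: "g n \<in> borel_measurable P" "h \<in> borel_measurable P" for n using g h by auto
  have [measurable]: "\<phi> \<in> borel_measurable borel" unfolding \<phi>[abs_def] by measurable
  define K where "K A = Liminf F (\<lambda>n. \<integral>\<^sup>+x\<in>A. \<phi> (g n x) \<partial>P)" for A
  have K_mono: "K A \<le> K B" if "A \<subseteq> B" for A B
    unfolding K_def using that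
    by (intro Liminf_mono always_eventually allI nn_integral_mono) (auto split: split_indicator)
  have affine: "set_lebesgue_integral P A (\<lambda>x. a i + b i * f x) = a i * measure P A + b i * set_lebesgue_integral P A f"
    if "A \<in> sets P" "integrable P f" for A i f
    using that integrable_mult_indicator[OF that] emeasure_finite[of A]
    unfolding set_lebesgue_integral_def by (simp add: algebra_simps less_top[symmetric])
  have "(\<integral>\<^sup>+x. (SUP i. ennreal (a i + b i * h x)) \<partial>P) \<le> K (space P)"
  proof (rule nn_integral_SUP_le_superadditive)
    fix A B assume [measurable]: "A \<in> sets P" "B \<in> sets P" and disj: "A \<inter> B = {}"
    have "K A + K B \<le> Liminf F (\<lambda>n. (\<integral>\<^sup>+x\<in>A. \<phi> (g n x) \<partial>P) + (\<integral>\<^sup>+x\<in>B. \<phi> (g n x) \<partial>P))"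
      unfolding K_def by (rule Liminf_add_ennreal)
    also have "\<dots> = K (A \<union> B)"
      unfolding K_def using disj
      by (subst nn_integral_add[symmetric])
         (auto intro!: arg_cong[where f="Liminf F"] ext nn_integral_cong split: split_indicator)
    finally show "K A + K B \<le> K (A \<union> B)" .
  next
    fix i A assume [measurable]: "A \<in> sets P"
    \<comment> \<open>\<^const>\<open>ennreal\<close> truncates at 0; on \<open>A'\<close> it does not, so the integral there is affine in \<open>h\<close>.\<close>
    define A' where "A' = {x \<in> A \<inter> space P. 0 < a i + b i * h x}"
    have [measurable]: "A' \<in> sets P" by (simp add: A'_def)
    have int: "integrable P (\<lambda>x. indicator A' x * (a i + b i * f x))" if "integrable P f" for f
      using integrable_mult_indicator[of A' P "\<lambda>x. a i + b i * f x"] that by simp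
    have "(\<integral>\<^sup>+x\<in>A. ennreal (a i + b i * h x) \<partial>P) = (\<integral>\<^sup>+x. ennreal (indicator A' x * (a i + b i * h x)) \<partial>P)"
      by (intro nn_integral_cong) (auto simp: A'_def ennreal_neg split: split_indicator)
    also have "\<dots> = ennreal (set_lebesgue_integral P A' (\<lambda>x. a i + b i * h x))"
      unfolding set_lebesgue_integral_def using int[OF h]
      by (subst nn_integral_eq_integral) (auto simp: A'_def split: split_indicator)
    also have "\<dots> \<le> K A'"
    proof -
      have "((\<lambda>n. ennreal (set_lebesgue_integral P A' (\<lambda>x. a i + b i * g n x))) \<longlongrightarrow>
          ennreal (set_lebesgue_integral P A' (\<lambda>x. a i + b i * h x))) F"
        using g h by (auto simp: affine intro!: tendsto_intros lim)
      then have "ennreal (set_lebesgue_integral P A' (\<lambda>x. a i + b i * h x)) =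
          Liminf F (\<lambda>n. ennreal (set_lebesgue_integral P A' (\<lambda>x. a i + b i * g n x)))"
        by (rule lim_imp_Liminf[OF F, symmetric])
      also have "\<dots> \<le> K A'"
        unfolding K_def
      proof (intro Liminf_mono always_eventually allI)
        fix n
        let ?f = "\<lambda>x. indicator A' x * (a i + b i * g n x)"
        have "ennreal (integral\<^sup>L P ?f) \<le> ennreal (\<integral>x. max 0 (?f x) \<partial>P)"
          using int[OF g] by (intro ennreal_leI integral_mono) auto
        also have "\<dots> = (\<integral>\<^sup>+x. ennreal (max 0 (?f x)) \<partial>P)"
          using int[OF g] by (intro nn_integral_eq_integral[symmetric]) auto
        also have "\<dots> \<le> (\<integral>\<^sup>+x\<in>A'. \<phi> (g n x) \<partial>P)"
          by (intro nn_integral_mono)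
             (auto simp: \<phi> max_def ennreal_neg intro!: SUP_upper split: split_indicator)
        finally show "ennreal (set_lebesgue_integral P A' (\<lambda>x. a i + b i * g n x)) \<le> (\<integral>\<^sup>+x\<in>A'. \<phi> (g n x) \<partial>P)"
          by (simp add: set_lebesgue_integral_def)
      qed
      finally show ?thesis .
    qed
    also have "K A' \<le> K A" by (rule K_mono) (auto simp: A'_def)
    finally show "(\<integral>\<^sup>+x\<in>A. ennreal (a i + b i * h x) \<partial>P) \<le> K A" .
  qed measurable
  then show ?thesis by (simp add: \<phi> K_def)
qed

section \<open>Setwise limits of dominated signed measures\<close>

text \<open>
  Round the values down to multiples of \<open>\<epsilon>\<close>.
\<close>

lemma bounded_measurable_uniform_simple_approximation:
  fixes f :: "'a \<Rightarrow> real"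
  assumes [measurable]: "f \<in> borel_measurable M" and "bounded (f ` space M)" and "0 < \<epsilon>"
  obtains s where "simple_function M s" "\<And>x. x \<in> space M \<Longrightarrow> \<bar>f x - s x\<bar> \<le> \<epsilon>"
proof -
  obtain K where K: "\<And>x. x \<in> space M \<Longrightarrow> \<bar>f x\<bar> \<le> K"
    using assms(2) by (auto simp: bounded_iff)
  define s where "s x = \<epsilon> * of_int \<lfloor>f x / \<epsilon>\<rfloor>" for x
  have "s ` space M \<subseteq> (\<lambda>i. \<epsilon> * of_int i) ` {\<lfloor>- K / \<epsilon>\<rfloor>..\<lfloor>K / \<epsilon>\<rfloor>}"
  proof
    fix y assume "y \<in> s ` space M"
    then obtain x where x: "x \<in> space M" "y = \<epsilon> * of_int \<lfloor>f x / \<epsilon>\<rfloor>" by (auto simp: s_def)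
    have "- K / \<epsilon> \<le> f x / \<epsilon>" "f x / \<epsilon> \<le> K / \<epsilon>"
      using K[OF x(1)] \<open>0 < \<epsilon>\<close> divide_right_mono[of "- K" "f x" \<epsilon>] divide_right_mono[of "f x" K \<epsilon>]
      by auto
    then show "y \<in> (\<lambda>i. \<epsilon> * of_int i) ` {\<lfloor>- K / \<epsilon>\<rfloor>..\<lfloor>K / \<epsilon>\<rfloor>}"
      unfolding x(2) by (intro imageI) (auto intro: floor_mono)
  qed
  then have "finite (s ` space M)" by (rule finite_subset) simp
  moreover have "s \<in> borel_measurable M" unfolding s_def by measurable
  ultimately have "simple_function M s" by (simp add: simple_function_borel_measurable)
  moreover have "\<bar>f x - s x\<bar> \<le> \<epsilon>" for x
  proof -
    have "\<bar>f x / \<epsilon> - of_int \<lfloor>f x / \<epsilon>\<rfloor>\<bar> \<le> 1" by linarith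
    then have "\<epsilon> * \<bar>f x / \<epsilon> - of_int \<lfloor>f x / \<epsilon>\<rfloor>\<bar> \<le> \<epsilon> * 1"
      using \<open>0 < \<epsilon>\<close> by (intro mult_left_mono) auto
    moreover have "f x - s x = \<epsilon> * (f x / \<epsilon> - of_int \<lfloor>f x / \<epsilon>\<rfloor>)"
      using \<open>0 < \<epsilon>\<close> by (simp add: s_def right_diff_distrib)
    then have "\<bar>f x - s x\<bar> = \<epsilon> * \<bar>f x / \<epsilon> - of_int \<lfloor>f x / \<epsilon>\<rfloor>\<bar>"
      using \<open>0 < \<epsilon>\<close> by (simp only: abs_mult abs_of_pos)
    ultimately show ?thesis by simp
  qed
  ultimately show thesis using that by blast
qed

text \<open>
  Linearity gives the convergence for simple functions in place of \<open>f\<close>. Since the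
  \<open>g n\<close> are bounded in \<open>L\<^sub>1\<close>, replacing \<open>f\<close> by a uniformly close simple function changes all the
  integrals by a uniformly small amount.
\<close>

lemma integral_mult_tendsto_of_setwise:
  fixes g :: "'i \<Rightarrow> 'a \<Rightarrow> real"
  assumes g: "\<And>n. integrable P (g n)" and h: "integrable P h"
    and bound: "\<And>n. (\<integral>x. \<bar>g n x\<bar> \<partial>P) \<le> C"
    and lim: "\<And>A. A \<in> sets P \<Longrightarrow>
      ((\<lambda>n. set_lebesgue_integral P A (g n)) \<longlongrightarrow> set_lebesgue_integral P A h) F"
    and f: "f \<in> borel_measurable P" "bounded (f ` space P)"
  shows "((\<lambda>n. \<integral>x. f x * g n x \<partial>P) \<longlongrightarrow> (\<integral>x. f x * h x \<partial>P)) F"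
proof (rule tendstoI)
  fix e :: real assume "0 < e"
  define D where "D = \<bar>C\<bar> + (\<integral>x. \<bar>h x\<bar> \<partial>P) + 1"
  have D: "0 < D" by (simp add: D_def add_nonneg_pos)
  define \<epsilon> where "\<epsilon> = e / (2 * D)"
  have \<epsilon>: "0 < \<epsilon>" "\<epsilon> * D = e / 2" using \<open>0 < e\<close> D by (auto simp: \<epsilon>_def)
  obtain s where s: "simple_function P s" "\<And>x. x \<in> space P \<Longrightarrow> \<bar>f x - s x\<bar> \<le> \<epsilon>"
    using bounded_measurable_uniform_simple_approximation[OF f \<epsilon>(1)] by blast
  have [measurable]: "s \<in> borel_measurable P" using s(1) by (rule borel_measurable_simple_function)
    have bs: "bounded (s ` space P)" using s(1) by (intro finite_imp_bounded) (simp add: simple_function_def)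
  have approx: "\<bar>(\<integral>x. f x * k x \<partial>P) - (\<integral>x. s x * k x \<partial>P)\<bar> \<le> \<epsilon> * (\<integral>x. \<bar>k x\<bar> \<partial>P)"
    if k: "integrable P k" for k
  proof -
    have "\<bar>(\<integral>x. f x * k x \<partial>P) - (\<integral>x. s x * k x \<partial>P)\<bar> = \<bar>\<integral>x. (f x - s x) * k x \<partial>P\<bar>"
      using integrable_bounded_mult[OF k f] integrable_bounded_mult[OF k \<open>s \<in> borel_measurable P\<close> bs] by (simp add: left_diff_distrib)
    also have "\<dots> \<le> (\<integral>x. \<bar>(f x - s x) * k x\<bar> \<partial>P)"
      by (rule integral_abs_bound)
    also have "\<dots> \<le> (\<integral>x. \<epsilon> * \<bar>k x\<bar> \<partial>P)"
    proof (rule integral_mono)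
      show "integrable P (\<lambda>x. \<bar>(f x - s x) * k x\<bar>)"
        using integrable_bounded_mult[OF k f] integrable_bounded_mult[OF k \<open>s \<in> borel_measurable P\<close> bs] by (simp add: left_diff_distrib)
      show "\<bar>(f x - s x) * k x\<bar> \<le> \<epsilon> * \<bar>k x\<bar>" if "x \<in> space P" for x
        using s(2)[OF that] by (simp add: abs_mult mult_right_mono)
    qed (use k in simp)
    finally show ?thesis by simp
  qed
  have simple: "(\<integral>x. s x * k x \<partial>P) = (\<Sum>y\<in>s ` space P. y * set_lebesgue_integral P {x \<in> space P. s x = y} k)"
    if k: "integrable P k" for k
  proof -
    have int: "integrable P (\<lambda>x. indicator {x \<in> space P. s x = y} x * k x)" for y
      using integrable_mult_indicator[of "{x \<in> space P. s x = y}" P k] k by simp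
    have fin: "finite (s ` space P)" using s(1) by (simp add: simple_function_def)
    have "(\<integral>x. s x * k x \<partial>P) = (\<integral>x. (\<Sum>y\<in>s ` space P. y * (indicator {x \<in> space P. s x = y} x * k x)) \<partial>P)"
    proof (rule Bochner_Integration.integral_cong)
      fix x assume x: "x \<in> space P"
      have "(\<Sum>y\<in>s ` space P. y * (indicator {x \<in> space P. s x = y} x * k x)) =
          (\<Sum>y\<in>s ` space P. if y = s x then y * k x else 0)"
        using x by (intro sum.cong) auto
      then show "s x * k x = (\<Sum>y\<in>s ` space P. y * (indicator {x \<in> space P. s x = y} x * k x))"
        using x fin by simp
    qed simp
    also have "\<dots> = (\<Sum>y\<in>s ` space P. y * set_lebesgue_integral P {x \<in> space P. s x = y} k)"
      unfolding set_lebesgue_integral_def by (simp add: int)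
    finally show ?thesis .
  qed
  have "((\<lambda>n. \<integral>x. s x * g n x \<partial>P) \<longlongrightarrow> (\<integral>x. s x * h x \<partial>P)) F"
    unfolding simple[OF g] simple[OF h] by (intro tendsto_intros lim) measurable
  from tendstoD[OF this half_gt_zero[OF \<open>0 < e\<close>]]
  have "\<forall>\<^sub>F n in F. \<bar>(\<integral>x. s x * g n x \<partial>P) - (\<integral>x. s x * h x \<partial>P)\<bar> < e / 2"
    by (simp only: dist_real_def)
  then show "\<forall>\<^sub>F n in F. dist (\<integral>x. f x * g n x \<partial>P) (\<integral>x. f x * h x \<partial>P) < e"
  proof eventually_elim
    case (elim n)
    have "\<epsilon> * (\<integral>x. \<bar>g n x\<bar> \<partial>P) + \<epsilon> * (\<integral>x. \<bar>h x\<bar> \<partial>P) \<le> \<epsilon> * D"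
      using \<epsilon>(1) bound[of n] unfolding distrib_left[symmetric] D_def by (intro mult_left_mono) auto
    with approx[OF g, of n] approx[OF h] elim \<epsilon>(2) show ?case
      unfolding dist_real_def by linarith
  qed
qed

text \<open>
  Eventual membership in a neighbourhood is preserved by finite intersections and by unions, so it has to be
  shown for the generating sets only, where it is convergence of the integrals of one bounded function.
\<close>

lemma limitin_tau_topology:
  assumes P: "finite_measure P"
    and Q: "\<And>n. Q n \<in> ac_signed_measures P" and R: "R \<in> ac_signed_measures P"
    and bound: "\<And>n. (\<integral>x. \<bar>signed_RN_deriv P (Q n) x\<bar> \<partial>P) \<le> C"
    and lim: "\<And>A. A \<in> sets P \<Longrightarrow> ((\<lambda>n. Q n A) \<longlongrightarrow> R A) F"
  shows "limitin (tau_topology P) Q R F"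
  unfolding limitin_def
proof (intro conjI allI impI)
  have sm: "R \<in> signed_measures P" "Q n \<in> signed_measures P" for n
    using Q R by (auto simp: ac_signed_measures_def)
  have "R \<in> {Q \<in> signed_measures P. signed_integral P Q (\<lambda>_. 0) \<in> UNIV}" using sm by simp
  then show "R \<in> topspace (tau_topology P)"
    unfolding tau_topology_def topology_generated_by_topspace
    by (intro UnionI[rotated], assumption) (force intro!: exI[of _ "\<lambda>_. 0"] exI[of _ UNIV] boundedI)
  have conv: "((\<lambda>n. signed_integral P (Q n) f) \<longlongrightarrow> signed_integral P R f) F"
    if f: "f \<in> borel_measurable P" "bounded (f ` space P)" for f
    unfolding signed_integral_eq_integral[OF P Q f] signed_integral_eq_integral[OF P R f]
  proof (rule integral_mult_tendsto_of_setwise[OF _ _ bound _ f])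
    fix A assume A: "A \<in> sets P"
    show "((\<lambda>n. set_lebesgue_integral P A (signed_RN_deriv P (Q n))) \<longlongrightarrow>
        set_lebesgue_integral P A (signed_RN_deriv P R)) F"
      using lim[OF A]
      unfolding signed_measure_eq_set_integral[OF P Q A] signed_measure_eq_set_integral[OF P R A] .
  qed (use P Q R in \<open>auto intro: integrable_signed_RN_deriv\<close>)
  fix U assume U: "openin (tau_topology P) U \<and> R \<in> U"
  then have "generate_topology_on
     {{Q \<in> signed_measures P. signed_integral P Q f \<in> U} | f U.
        f \<in> borel_measurable P \<and> bounded (f ` space P) \<and> open U} U"
    by (auto simp: tau_topology_def dest: openin_topology_generated_by)
  then show "\<forall>\<^sub>F n in F. Q n \<in> U"
    using conjunct2[OF U]
  proof induction
    case (Int a b)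
    then show ?case by (auto intro: eventually_conj)
  next
    case (UN \<K>)
    then obtain k where "k \<in> \<K>" "R \<in> k" by blast
    with UN have "\<forall>\<^sub>F n in F. Q n \<in> k" by blast
    then show ?case using \<open>k \<in> \<K>\<close> by (auto elim: eventually_mono)
  next
    case (Basis s)
    then obtain f V where f: "f \<in> borel_measurable P" "bounded (f ` space P)" and V: "open V"
      and s: "s = {Q \<in> signed_measures P. signed_integral P Q f \<in> V}" by blast
    have "\<forall>\<^sub>F n in F. signed_integral P (Q n) f \<in> V"
      using Basis(2) s by (intro topological_tendstoD[OF conv[OF f] V]) auto
    then show ?case using sm by (simp add: s)
  qed simp
qed

text \<open>
  Finite additivity is inherited from the \<open>Q n\<close>. Countable additivity is not inherited in general;
  here it holds because the value of \<open>R\<close> on the tail of a disjoint union is squeezed between the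
  integrals of \<open>lo\<close> and \<open>hi\<close> over that tail, which tend to 0.
\<close>

lemma ac_signed_measure_dominated_limit:
  fixes P :: "'a measure"
  assumes Q: "\<And>n. Q n \<in> ac_signed_measures P" and F: "F \<noteq> bot"
    and lim: "\<And>A. A \<in> sets P \<Longrightarrow> ((\<lambda>n. Q n A) \<longlongrightarrow> R A) F"
    and zero: "\<And>A. A \<notin> sets P \<Longrightarrow> R A = 0"
    and lo: "integrable P lo" and hi: "integrable P hi"
    and ge: "\<And>A n. A \<in> sets P \<Longrightarrow> set_lebesgue_integral P A lo \<le> Q n A"
    and le: "\<And>A n. A \<in> sets P \<Longrightarrow> Q n A \<le> set_lebesgue_integral P A hi"
  shows "R \<in> ac_signed_measures P"
proof -
  have sm: "Q n \<in> signed_measures P" for n using Q by (simp add: ac_signed_measures_def)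
  have null: "R A = 0" if "A \<in> sets P" "\<And>n. Q n A = 0" for A
    using lim[OF that(1)] that(2) F by (simp add: tendsto_const_iff)
  have add: "R (A \<union> B) = R A + R B" if "A \<in> sets P" "B \<in> sets P" "A \<inter> B = {}" for A B
  proof (rule tendsto_unique[OF F])
    show "((\<lambda>n. Q n (A \<union> B)) \<longlongrightarrow> R (A \<union> B)) F" using that by (intro lim) auto
    show "((\<lambda>n. Q n (A \<union> B)) \<longlongrightarrow> R A + R B) F"
      using that by (simp add: signed_measure_Un[OF sm] tendsto_add lim)
  qed
  have empty: "R {} = 0" by (rule null) (auto intro: signed_measure_empty sm)
  have ge': "set_lebesgue_integral P A lo \<le> R A" and le': "R A \<le> set_lebesgue_integral P A hi"
    if "A \<in> sets P" for A
    using tendsto_lowerbound[OF lim[OF that] _ F] tendsto_upperbound[OF lim[OF that] _ F] ge le that by auto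
  have "(\<lambda>i. R (A i)) sums R (\<Union>i. A i)" if A: "range A \<subseteq> sets P" "disjoint_family A" for A :: "nat \<Rightarrow> 'a set"
  proof -
    have [measurable]: "A i \<in> sets P" for i using A by auto
    define T where "T n = (\<Union>i. A i) - (\<Union>i<n. A i)" for n
    have [measurable]: "T n \<in> sets P" for n unfolding T_def by measurable
    have part: "R (\<Union>i<n. A i) = (\<Sum>i<n. R (A i))" for n
    proof (induction n)
      case (Suc n)
      have "(\<Union>i<n. A i) \<inter> A n = {}"
        using disjoint_family_onD[OF A(2), of _ n] by (simp add: UN_iff disjoint_iff) (metis lessThan_iff less_irrefl)
      then have "R ((\<Union>i<n. A i) \<union> A n) = R (\<Union>i<n. A i) + R (A n)"
        by (intro add) auto
      moreover have "(\<Union>i<Suc n. A i) = (\<Union>i<n. A i) \<union> A n" by (auto simp: less_Suc_eq)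
      ultimately show ?case using Suc by simp
    qed (simp add: empty)
    have tail: "R (\<Union>i. A i) - (\<Sum>i<n. R (A i)) = R (T n)" for n
    proof -
      have "(\<Union>i. A i) = (\<Union>i<n. A i) \<union> T n" by (auto simp: T_def)
      moreover have "R ((\<Union>i<n. A i) \<union> T n) = R (\<Union>i<n. A i) + R (T n)"
        by (intro add) (auto simp: T_def)
      ultimately show ?thesis by (simp add: part)
    qed
    have "decseq T" by (force simp: decseq_def T_def)
    have "(\<Inter>n. T n) = {}" by (auto simp: T_def)
    then have vanish: "(\<lambda>n. set_lebesgue_integral P (T n) k) \<longlonglongrightarrow> 0" if "integrable P k" for k :: "'a \<Rightarrow> real"
      using set_integral_cont_down[of T P k] \<open>decseq T\<close> integrable_mult_indicator[OF _ that, of "T 0"]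
      by (simp add: set_integrable_def set_lebesgue_integral_def)
    have "(\<lambda>n. R (T n)) \<longlonglongrightarrow> 0"
      by (rule tendsto_sandwich[OF _ _ vanish[OF lo] vanish[OF hi]]) (auto intro!: always_eventually ge' le')
    then have "(\<lambda>n. R (\<Union>i. A i) - (R (\<Union>i. A i) - (\<Sum>i<n. R (A i)))) \<longlonglongrightarrow> R (\<Union>i. A i) - 0"
      unfolding tail by (intro tendsto_intros)
    then show ?thesis by (simp add: sums_def)
  qed
  moreover have "R A = 0" if "A \<in> sets P" "emeasure P A = 0" for A
    using that Q by (intro null) (auto simp: ac_signed_measures_def)
  ultimately show ?thesis
    using empty zero by (simp add: ac_signed_measures_def signed_measures_def)
qed

text \<open>
  Tychonoff's theorem: the image of the sequential filter under \<open>Q\<close> has a cluster point in the box,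
  and \<open>F\<close> is the sequential filter restricted to the indices whose \<open>Q n\<close> are near that point.
\<close>

lemma coordinatewise_cluster_filter:
  fixes Q :: "nat \<Rightarrow> 'b \<Rightarrow> real"
  assumes "\<And>n i. lo i \<le> Q n i" "\<And>n i. Q n i \<le> hi i"
  obtains F R where "F \<noteq> bot" "F \<le> sequentially" "\<And>i. ((\<lambda>n. Q n i) \<longlongrightarrow> R i) F"
proof -
  define box where "box = (\<Pi>\<^sub>E i\<in>UNIV. {lo i..hi i})"
  have "compactin (product_topology (\<lambda>i. euclidean) UNIV) box"
    unfolding box_def by (subst compactin_PiE) auto
  then have "compact box" by (simp add: euclidean_product_topology)
  moreover have "Q n \<in> box" for n using assms by (auto simp: box_def)
  then have "eventually (\<lambda>q. q \<in> box) (filtermap Q sequentially)" by (simp add: eventually_filtermap)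
  ultimately obtain R where R: "inf (nhds R) (filtermap Q sequentially) \<noteq> bot"
    unfolding compact_filter by (metis filtermap_bot_iff trivial_limit_sequentially)
  define F where "F = inf (filtercomap Q (nhds R)) sequentially"
  have "F \<noteq> bot"
  proof
    assume "F = bot"
    then have "eventually (\<lambda>_. False) (inf (filtercomap Q (nhds R)) sequentially)" by (simp add: F_def)
    then obtain P1 P2 where P: "eventually P1 (nhds R)" "eventually P2 sequentially"
      "\<And>n. P1 (Q n) \<Longrightarrow> P2 n \<Longrightarrow> False"
      unfolding eventually_inf eventually_filtercomap by blast
    have "eventually (\<lambda>q. \<not> P1 q) (filtermap Q sequentially)"
      unfolding eventually_filtermap using P(2) by eventually_elim (use P(3) in blast)
    with P(1) have "eventually (\<lambda>_. False) (inf (nhds R) (filtermap Q sequentially))"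
      unfolding eventually_inf by blast
    with R show False by (simp add: trivial_limit_def)
  qed
  moreover have "F \<le> sequentially" by (simp add: F_def)
  moreover have "((\<lambda>n. Q n i) \<longlongrightarrow> R i) F" for i
  proof -
    have "(Q \<longlongrightarrow> R) F" unfolding F_def filterlim_def
      by (metis filtermap_filtercomap filtermap_mono inf.cobounded1 order_trans)
    then show ?thesis
      using continuous_on_tendsto_compose[OF continuous_on_product_coordinates[of i]] by auto
  qed
  ultimately show thesis using that by blast
qed

section \<open>Existence of the projection\<close>

lemma minimising_sequence:
  fixes f :: "'b \<Rightarrow> ennreal"
  assumes "(INF q\<in>S. f q) < \<infinity>"
  obtains X :: "nat \<Rightarrow> 'b" where "\<And>n. X n \<in> S" "\<And>n. f (X n) < \<infinity>" "(\<lambda>n. f (X n)) \<longlonglongrightarrow> (INF q\<in>S. f q)"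
proof -
  let ?m = "INF q\<in>S. f q"
  obtain m where m: "?m = ennreal m" "0 \<le> m" using assms by (cases ?m) auto
  have "\<exists>q\<in>S. f q < ?m + ennreal (inverse (real (Suc n)))" for n
  proof -
    have "ennreal m < ennreal (m + inverse (real (Suc n)))"
      using m(2) by (intro ennreal_lessI) (auto intro: add_nonneg_pos)
    also have "\<dots> = ?m + ennreal (inverse (real (Suc n)))"
      unfolding m(1) using m(2) by (intro ennreal_plus) auto
    finally have "?m < ?m + ennreal (inverse (real (Suc n)))" by (simp only: m(1))
    then show ?thesis unfolding INF_less_iff .
  qed
  then obtain X where X: "\<And>n. X n \<in> S" "\<And>n. f (X n) < ?m + ennreal (inverse (real (Suc n)))" by metis
  have "(\<lambda>n. ?m + ennreal (inverse (real (Suc n)))) \<longlonglongrightarrow> ?m + ennreal 0"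
    by (rule tendsto_add[OF tendsto_const tendsto_ennrealI[OF LIMSEQ_inverse_real_of_nat]])
  then have up: "(\<lambda>n. ?m + ennreal (inverse (real (Suc n)))) \<longlonglongrightarrow> ?m" by simp
  have "(\<lambda>n. f (X n)) \<longlonglongrightarrow> ?m"
    by (rule tendsto_sandwich[OF _ _ tendsto_const up])
       (rule always_eventually, rule allI, rule INF_lower less_imp_le, rule X)+
  moreover have "f (X n) < \<infinity>" for n
    using X(2)[of n] assms by (metis ennreal_add_less_top ennreal_less_top infinity_ennreal_def order.strict_trans)
  ultimately show thesis using that X(1) by blast
qed

theorem corollary2p12:
  fixes P :: "'a measure" and \<phi> :: "real \<Rightarrow> ennreal"
    and \<Omega> :: "('a set \<Rightarrow> real) set" and u l :: "'a \<Rightarrow> real"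
  assumes "prob_space P"
    and "divergence_function \<phi>"
    and "closedin (tau_topology P) \<Omega>"
    and "integrable P u" and "integrable P l"
    and "\<And>Q. Q \<in> \<Omega> \<inter> dom_divergence \<phi> P \<Longrightarrow>
           AE x in P. u x \<le> signed_RN_deriv P Q x \<and> signed_RN_deriv P Q x \<le> l x"
    and "phi_divergence_set \<phi> P \<Omega> < \<infinity>"
  shows "\<exists>Q. is_phi_projection \<phi> P \<Omega> Q"
proof -
  interpret prob_space P by fact
  note P = finite_measure_axioms
  obtain Q where Q\<Omega>: "\<And>n::nat. Q n \<in> \<Omega>" and fin: "\<And>n. phi_divergence \<phi> P (Q n) < \<infinity>"
    and inf: "(\<lambda>n. phi_divergence \<phi> P (Q n)) \<longlonglongrightarrow> phi_divergence_set \<phi> P \<Omega>"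
    using minimising_sequence assms(7) unfolding phi_divergence_set_def by metis
  have Q: "Q n \<in> ac_signed_measures P" for n
    using fin[of n] by (auto simp: phi_divergence_def split: if_splits)
  define g where "g n = signed_RN_deriv P (Q n)" for n
  have g: "integrable P (g n)" "A \<in> sets P \<Longrightarrow> Q n A = set_lebesgue_integral P A (g n)" for n A
    unfolding g_def by (intro integrable_signed_RN_deriv signed_measure_eq_set_integral P Q)+
  have AE: "AE x in P. u x \<le> g n x \<and> g n x \<le> l x" for n
    unfolding g_def using Q\<Omega> fin Q by (intro assms(6)) (auto simp: dom_divergence_def ac_signed_measures_def)
  have set_int: "set_integrable P A k" if "A \<in> sets P" "integrable P k" for A and k :: "'a \<Rightarrow> real"
    using integrable_mult_indicator[OF that] by (simp add: set_integrable_def)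
  have ge: "set_lebesgue_integral P A u \<le> Q n A" and le: "Q n A \<le> set_lebesgue_integral P A l"
    if "A \<in> sets P" for A n
    unfolding g(2)[OF that] using AE[of n] that assms(4,5) g(1)
    by (auto intro!: set_integral_mono_AE set_int elim: eventually_mono)
  have outside: "Q n A = 0" if "A \<notin> sets P" for n A
    using Q[of n] that by (auto simp: ac_signed_measures_def signed_measures_def)
  \<comment> \<open>Signed measures vanish on nonmeasurable sets, so the box is a point in those coordinates.\<close>
  have lower: "(if A \<in> sets P then set_lebesgue_integral P A u else 0) \<le> Q n A" for n A
    using ge outside by simp
  have upper: "Q n A \<le> (if A \<in> sets P then set_lebesgue_integral P A l else 0)" for n A
    using le outside by simp
  obtain F R where F: "F \<noteq> bot" "F \<le> sequentially" and lim: "\<And>A. ((\<lambda>n. Q n A) \<longlongrightarrow> R A) F"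
    using coordinatewise_cluster_filter[where Q=Q and
        lo="\<lambda>A. if A \<in> sets P then set_lebesgue_integral P A u else 0" and
        hi="\<lambda>A. if A \<in> sets P then set_lebesgue_integral P A l else 0", OF lower upper] by metis
  have "R A = 0" if "A \<notin> sets P" for A
    using lim[of A] F(1) by (simp add: outside[OF that] tendsto_const_iff)
  then have R: "R \<in> ac_signed_measures P"
    using ac_signed_measure_dominated_limit[OF Q F(1) lim _ assms(4,5) ge le] by blast
  have "limitin (tau_topology P) Q R F"
  proof (rule limitin_tau_topology[OF P Q R _ lim])
    fix n
    show "(\<integral>x. \<bar>signed_RN_deriv P (Q n) x\<bar> \<partial>P) \<le> (\<integral>x. \<bar>u x\<bar> + \<bar>l x\<bar> \<partial>P)"
      unfolding g_def[symmetric]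
    proof (rule integral_mono_AE)
      show "AE x in P. \<bar>g n x\<bar> \<le> \<bar>u x\<bar> + \<bar>l x\<bar>"
        using AE[of n] by eventually_elim linarith
    qed (use g(1) assms(4,5) in auto)
  qed
  then have "R \<in> \<Omega>"
    by (rule limitin_closedin[OF _ assms(3)]) (use Q\<Omega> F(1) in auto)
  moreover have "phi_divergence \<phi> P R \<le> phi_divergence \<phi> P Q'" if "Q' \<in> \<Omega>" for Q'
  proof -
    obtain a b :: "nat \<Rightarrow> real" where \<phi>: "\<And>y. \<phi> y = (SUP i. ennreal (a i + b i * y))"
      using countable_affine_representation[OF assms(2)] by blast
    have "phi_divergence \<phi> P R = (\<integral>\<^sup>+x. \<phi> (signed_RN_deriv P R x) \<partial>P)"
      using R by (simp add: phi_divergence_def)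
    also have "\<dots> \<le> Liminf F (\<lambda>n. \<integral>\<^sup>+x. \<phi> (g n x) \<partial>P)"
    proof (rule convex_integral_lower_semicontinuous[OF P \<phi> g(1) integrable_signed_RN_deriv[OF P R] _ F(1)])
      fix A assume A: "A \<in> sets P"
      show "((\<lambda>n. set_lebesgue_integral P A (g n)) \<longlongrightarrow> set_lebesgue_integral P A (signed_RN_deriv P R)) F"
        using lim[of A] unfolding g(2)[OF A] signed_measure_eq_set_integral[OF P R A] .
    qed
    also have "(\<lambda>n. \<integral>\<^sup>+x. \<phi> (g n x) \<partial>P) = (\<lambda>n. phi_divergence \<phi> P (Q n))"
      using Q by (simp add: phi_divergence_def g_def)
    also have "Liminf F \<dots> = phi_divergence_set \<phi> P \<Omega>"
      by (rule lim_imp_Liminf[OF F(1) tendsto_mono[OF F(2) inf]])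
    also have "\<dots> \<le> phi_divergence \<phi> P Q'"
      unfolding phi_divergence_set_def by (rule INF_lower[OF that])
    finally show ?thesis .
  qed
  ultimately show ?thesis by (auto simp: is_phi_projection_def)
qed

end
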